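(* Let $V$ be a Euclidean Jordan algebra with cone of squares $Q$. Then every Jordan subalgebra $L$ of $V$ is a lattice-like subspace of $(V,Q)$.
   Context: A Euclidean Jordan algebra $V$ is a finite-dimensional real vector space with a commutative bilinear product $(x,y)\mapsto xy$ satisfying $x^2(xy)=x(x^2y)$, with a unit element $e$, and with an inner product $\langle\cdot,\cdot\rangle$ such that $\langle xy,z\rangle=\langle y,xz\rangle$ for all $x,y,z\in V$. Its cone of squares is $Q=\{x^2: x\in V\}$, a closed convex self-dual cone. A Jordan subalgebra is a linear subspace of $V$ closed under the product. For a nonempty closed convex set $D\subset V$, $P_D$ denotes the metric (nearest point) projection onto $D$. The lattice-like operations are $x\sqcap_Q y=P_{x-Q}\,y$ and $x\sqcup_Q y=P_{x+Q}\,y$. A set $M\subset V$ is called lattice-like in $(V,Q)$ if $x\sqcap_Q y\in M$ and $x\sqcup_Q y\in M$ for all $x,y\in M$. A lattice-like subspace is a linear subspace which is a lattice-like set. *)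

theory Defs
  imports "HOL-Analysis.Analysis"
begin

(* The sort {real_inner, heine_borel} is that of closest_point. For an inner product space,
   heine_borel is equivalent to finite dimension. Unlike euclidean_space, this sort
   includes the zero space. The inner product of the algebra is that of the type. *)

locale euclidean_jordan_algebra =
  fixes jmul :: "'a::{real_inner,heine_borel} \<Rightarrow> 'a \<Rightarrow> 'a"  (infixl "\<bullet>\<^sub>J" 70)
    and e :: 'a
  assumes finite_dim: "\<exists>B::'a set. finite B \<and> span B = UNIV"
    and bilinear_jmul: "bilinear (\<bullet>\<^sub>J)"
    and jmul_commute: "x \<bullet>\<^sub>J y = y \<bullet>\<^sub>J x"
    and jordan_identity: "(x \<bullet>\<^sub>J x) \<bullet>\<^sub>J (x \<bullet>\<^sub>J y) = x \<bullet>\<^sub>J ((x \<bullet>\<^sub>J x) \<bullet>\<^sub>J y)"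
    and unit: "e \<bullet>\<^sub>J x = x"
    and jmul_assoc_inner: "inner (x \<bullet>\<^sub>J y) z = inner y (x \<bullet>\<^sub>J z)"

definition cone_of_squares :: "('a \<Rightarrow> 'a \<Rightarrow> 'a) \<Rightarrow> 'a set"
  where "cone_of_squares m = {m x x | x. True}"

(* A subalgebra need not contain the unit. *)
definition jordan_subalgebra :: "('a::real_vector \<Rightarrow> 'a \<Rightarrow> 'a) \<Rightarrow> 'a set \<Rightarrow> bool"
  where "jordan_subalgebra m L \<longleftrightarrow> subspace L \<and> (\<forall>x\<in>L. \<forall>y\<in>L. m x y \<in> L)"

definition lmeet :: "'a::{real_inner,heine_borel} set \<Rightarrow> 'a \<Rightarrow> 'a \<Rightarrow> 'a"
  where "lmeet Q x y = closest_point {x - q | q. q \<in> Q} y"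

definition ljoin :: "'a::{real_inner,heine_borel} set \<Rightarrow> 'a \<Rightarrow> 'a \<Rightarrow> 'a"
  where "ljoin Q x y = closest_point {x + q | q. q \<in> Q} y"

definition lattice_like :: "'a::{real_inner,heine_borel} set \<Rightarrow> 'a set \<Rightarrow> bool"
  where "lattice_like Q M \<longleftrightarrow> (\<forall>x\<in>M. \<forall>y\<in>M. lmeet Q x y \<in> M \<and> ljoin Q x y \<in> M)"

definition lattice_like_subspace :: "'a::{real_inner,heine_borel} set \<Rightarrow> 'a set \<Rightarrow> bool"
  where "lattice_like_subspace Q L \<longleftrightarrow> subspace L \<and> lattice_like Q L"

end

theory Submission
  imports Defs
begin

text \<open>For \<open>z\<close> in a subalgebra \<open>L\<close>, multiplication by \<open>z\<close> is self-adjoint, so on the span of the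
  powers of \<open>z\<close> it is diagonalizable. The eigencomponents \<open>b\<^sub>\<lambda>\<close> of \<open>z\<close> lie in \<open>L\<close> and satisfy
  \<open>b\<^sub>\<lambda> b\<^sub>\<mu> = 0\<close> and \<open>b\<^sub>\<lambda>\<^sup>2 = \<lambda> b\<^sub>\<lambda>\<close>, so \<open>b\<^sub>\<lambda> / \<lambda>\<close> are orthogonal idempotents, whose inner
  products with squares are nonnegative. Hence the sum of the \<open>b\<^sub>\<lambda>\<close> with \<open>\<lambda> > 0\<close> is the nearest
  point to \<open>z\<close> in the cone of squares, and it lies in \<open>L\<close>. The variational inequality gives
  uniqueness without convexity or closedness of the cone.\<close>

section \<open>Orthogonal bases in finite-dimensional inner product spaces\<close>

text \<open>Gram-Schmidt applied to a maximal independent subset of \<open>U\<close>; dropping zero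
  keeps the span and permits division by \<open>inner d d\<close>.\<close>

lemma finite_dim_orthogonal_basis:
  fixes U B :: "'a::real_inner set"
  assumes "subspace U" and "finite B" and "U \<subseteq> span B"
  obtains D where "finite D" "pairwise orthogonal D" "0 \<notin> D" "span D = U"
proof -
  obtain C where C: "C \<subseteq> U" "independent C" "U \<subseteq> span C"
    using maximal_independent_subset[of U] by auto
  have "finite C"
    using independent_span_bound[OF assms(2) C(2)] C(1) assms(3) by auto
  then obtain D where D: "finite D" "span D = span C" "pairwise orthogonal D"
    using basis_orthogonal[of C] by auto
  have "span C = U"
    using C assms(1) span_minimal by blast
  show ?thesis
    by (rule that[of "D - {0}"]) (use D \<open>span C = U\<close> in \<open>auto simp: pairwise_def span_delete_0\<close>)
qed

text \<open>The converse direction turns the formula into a membership test: a span becomes the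
  solution set of a continuous equation, hence closed.\<close>

lemma orthogonal_expansion:
  fixes D :: "'a::real_inner set"
  assumes "finite D" "pairwise orthogonal D" "0 \<notin> D"
  shows "x \<in> span D \<longleftrightarrow> x = (\<Sum>d\<in>D. (inner x d / inner d d) *\<^sub>R d)"
proof
  assume "x \<in> span D"
  then show "x = (\<Sum>d\<in>D. (inner x d / inner d d) *\<^sub>R d)"
  proof (induction rule: span_induct_alt)
    case base
    show ?case by simp
  next
    case (step c b y)
    have "(\<Sum>d\<in>D. (inner (c *\<^sub>R b) d / inner d d) *\<^sub>R d)
        = (\<Sum>d\<in>D. if d = b then c *\<^sub>R b else 0)"
      using step(1) assms(2,3)
      by (intro sum.cong) (auto simp: pairwise_def orthogonal_def)
    also have "\<dots> = c *\<^sub>R b"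
      using assms(1) step(1) by simp
    finally show ?case
      using step(2) by (simp add: inner_add_left add_divide_distrib scaleR_add_left sum.distrib)
  qed
next
  assume "x = (\<Sum>d\<in>D. (inner x d / inner d d) *\<^sub>R d)"
  then show "x \<in> span D"
    by (metis (no_types, lifting) span_scale span_base span_sum)
qed

lemma finite_dim_subspace_closed:
  fixes U B :: "'a::real_inner set"
  assumes "subspace U" and "finite B" and "U \<subseteq> span B"
  shows "closed U"
proof -
  obtain D where D: "finite D" "pairwise orthogonal D" "0 \<notin> D" "span D = U"
    using finite_dim_orthogonal_basis[OF assms] .
  have "U = {x. x = (\<Sum>d\<in>D. (inner x d / inner d d) *\<^sub>R d)}"
    using orthogonal_expansion[OF D(1-3)] D(4) by auto
  also have "closed \<dots>"
    using D(3) by (intro closed_Collect_eq continuous_intros) auto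
  finally show ?thesis .
qed

lemma finite_dim_orthogonal_projection:
  fixes U B :: "'a::real_inner set"
  assumes "subspace U" and "finite B" and "U \<subseteq> span B"
  obtains p where "p \<in> U" "\<And>u. u \<in> U \<Longrightarrow> inner (x - p) u = 0"
proof -
  obtain D where D: "finite D" "pairwise orthogonal D" "0 \<notin> D" "span D = U"
    using finite_dim_orthogonal_basis[OF assms] .
  define p where "p = (\<Sum>d\<in>D. (inner x d / inner d d) *\<^sub>R d)"
  have "p \<in> U"
    unfolding p_def D(4)[symmetric] by (intro span_sum span_scale span_base)
  moreover have "inner (x - p) u = 0" if "u \<in> U" for u
  proof -
    have "inner (x - p) d = 0" if "d \<in> D" for d
    proof -
      have "inner p d = (\<Sum>b\<in>D. if b = d then inner x d else 0)"
        unfolding p_def inner_sum_left using that D(2,3)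
        by (intro sum.cong) (auto simp: pairwise_def orthogonal_def)
      also have "\<dots> = inner x d"
        using D(1) that by simp
      finally show ?thesis
        by (simp add: inner_diff_left)
    qed
    moreover have "u \<in> span D" using that D(4) by simp
    ultimately show ?thesis
      by (metis orthogonal_def orthogonal_to_span)
  qed
  ultimately show ?thesis using that by blast
qed

text \<open>The orthogonal expansion writes \<open>T x\<close> as a finite sum of fixed vectors with
  coefficients continuous in \<open>x\<close>.\<close>

lemma finite_dim_linear_continuous_on:
  fixes T :: "'a::real_inner \<Rightarrow> 'b::real_normed_vector" and B :: "'a set"
  assumes "linear T" and "finite B" and "span B = UNIV"
  shows "continuous_on S T"
proof -
  interpret linear T by fact
  obtain D where D: "finite D" "pairwise orthogonal D" "0 \<notin> D" "span D = (UNIV :: 'a set)"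
    using finite_dim_orthogonal_basis[of UNIV B] assms by auto
  have expansion: "T x = (\<Sum>d\<in>D. (inner x d / inner d d) *\<^sub>R T d)" for x
    using orthogonal_expansion[OF D(1-3), of x] D(4) by (metis (no_types, lifting) UNIV_I scale sum sum.cong)
  have "continuous_on S (\<lambda>x. \<Sum>d\<in>D. (inner x d / inner d d) *\<^sub>R T d)"
    using D(3) by (intro continuous_intros) auto
  then show ?thesis
    by (rule continuous_on_eq) (rule expansion[symmetric])
qed

section \<open>Diagonalization of self-adjoint operators\<close>

text \<open>An eigenvector maximises the quadratic form on the unit sphere of the subspace.\<close>

lemma self_adjoint_eigenvector_exists:
  fixes T :: "'a::{real_inner,heine_borel} \<Rightarrow> 'a" and B W :: "'a set"
  assumes fin: "finite B" "span B = UNIV" and lin: "linear T"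
    and adj: "\<And>x y. inner (T x) y = inner x (T y)"
    and W: "subspace W" "\<And>w. w \<in> W \<Longrightarrow> T w \<in> W" "W \<noteq> {0}"
  obtains v c where "v \<in> W" "v \<noteq> 0" "T v = c *\<^sub>R v"
proof -
  interpret linear T by fact
  let ?S = "W \<inter> sphere 0 1"
  have "closed W" using finite_dim_subspace_closed[OF W(1) fin(1)] fin(2) by simp
  moreover have "sphere (0::'a) 1 = {x. norm x = 1}" by auto
  then have "closed (sphere (0::'a) 1)"
    by (simp only:) (intro closed_Collect_eq continuous_intros)
  ultimately have "closed ?S" by (rule closed_Int)
  moreover have "bounded ?S" by (rule bounded_subset[OF bounded_cball[of 0 1]]) auto
  ultimately have "compact ?S" by (simp add: compact_eq_bounded_closed)
  moreover obtain w where w: "w \<in> W" "w \<noteq> 0"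
    using W(1,3) subspace_0 by blast
  then have "(1 / norm w) *\<^sub>R w \<in> ?S"
    using W(1) by (simp add: subspace_scale)
  then have "?S \<noteq> {}" by blast
  moreover have "continuous_on ?S (\<lambda>x. inner (T x) x)"
    by (intro continuous_intros finite_dim_linear_continuous_on[OF lin fin])
  ultimately obtain v where v: "v \<in> ?S" and max: "\<And>x. x \<in> ?S \<Longrightarrow> inner (T x) x \<le> inner (T v) v"
    using continuous_attains_sup[of ?S "\<lambda>x. inner (T x) x"] by blast
  define c where "c = inner (T v) v"
  \<comment> \<open>\<open>g\<close> is a quadratic form, nonnegative on \<open>W\<close> and zero
    at \<open>v\<close>. The vector \<open>u\<close> is half its gradient at \<open>v\<close>, so
    minimality of \<open>g\<close> at \<open>v\<close> forces \<open>u = 0\<close>.\<close>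
  define g where "g u = c * inner u u - inner (T u) u" for u
  define u where "u = c *\<^sub>R v - T v"
  have vv: "inner v v = 1" using v by (simp add: norm_eq_1)
  have g_nonneg: "g x \<ge> 0" if "x \<in> W" for x
  proof (cases "x = 0")
    case False
    then have "(1 / norm x) *\<^sub>R x \<in> ?S"
      using W(1) that by (simp add: subspace_scale)
    from max[OF this] have "inner (T x) x / (norm x)\<^sup>2 \<le> c"
      by (simp add: scale c_def power2_eq_square)
    then show ?thesis
      using False by (simp add: g_def field_simps dot_square_norm)
  qed (simp add: g_def zero)
  have uW: "u \<in> W"
    unfolding u_def using v W by (auto intro: subspace_diff subspace_scale)
  have g_line: "g (v + t *\<^sub>R u) = 2 * t * inner u u + t\<^sup>2 * g u" for t
  proof -
    have "inner (T u) v = inner (T v) u" by (metis adj inner_commute)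
    then have "g (v + t *\<^sub>R u) = g v + 2 * t * (c * inner v u - inner (T v) u) + t\<^sup>2 * g u"
      by (simp add: g_def add scale inner_add_left inner_add_right power2_eq_square
          algebra_simps inner_commute[of u v])
    moreover have "g v = 0" by (simp add: g_def c_def vv)
    moreover have "c * inner v u - inner (T v) u = inner u u"
      by (simp add: u_def inner_diff_left)
    ultimately show ?thesis by simp
  qed
  have "inner u u = 0"
  proof (rule ccontr)
    assume "inner u u \<noteq> 0"
    then have a: "inner u u > 0" using inner_ge_zero[of u] by linarith
    \<comment> \<open>Moving from \<open>v\<close> against the gradient by this amount makes
      \<open>g\<close> negative; the added 1 keeps the denominator positive even when
      \<open>g u = 0\<close>.\<close>
    define t where "t = - inner u u / (g u + 1)"
    have gu: "g u + 1 > 0" using g_nonneg[OF uW] by simp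
    have "t < 0" unfolding t_def using a gu by simp
    have "v + t *\<^sub>R u \<in> W" using v uW W(1) by (auto intro: subspace_add subspace_scale)
    moreover have "g (v + t *\<^sub>R u) = t * (2 * inner u u + t * g u)"
      unfolding g_line by (simp add: power2_eq_square distrib_left)
    ultimately have "0 \<le> t * (2 * inner u u + t * g u)"
      using g_nonneg by metis
    then have "2 * inner u u + t * g u \<le> 0"
      using \<open>t < 0\<close> by (simp add: zero_le_mult_iff)
    moreover have "t * g u = - inner u u - t"
      unfolding t_def using gu by (simp add: field_simps)
    ultimately show False using a \<open>t < 0\<close> by linarith
  qed
  then have "T v = c *\<^sub>R v" by (simp add: u_def)
  then show ?thesis using that v by force
qed

text \<open>By self-adjointness, the vectors of \<open>W\<close> orthogonal to all eigenvectors form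
  an invariant subspace. Were it nonzero, it would contain an eigenvector orthogonal to
  itself.\<close>

lemma self_adjoint_span_eigenvectors:
  fixes T :: "'a::{real_inner,heine_borel} \<Rightarrow> 'a" and B W :: "'a set"
  assumes fin: "finite B" "span B = UNIV" and lin: "linear T"
    and adj: "\<And>x y. inner (T x) y = inner x (T y)"
    and W: "subspace W" "\<And>w. w \<in> W \<Longrightarrow> T w \<in> W"
  shows "span {v \<in> W. \<exists>c. T v = c *\<^sub>R v} = W"
proof
  define E where "E = {v \<in> W. \<exists>c. T v = c *\<^sub>R v}"
  show sub: "span {v \<in> W. \<exists>c. T v = c *\<^sub>R v} \<subseteq> W"
    using W(1) by (intro span_minimal) auto
  define W' where "W' = {w \<in> W. \<forall>v\<in>E. inner w v = 0}"
  have W': "subspace W'" "\<And>w. w \<in> W' \<Longrightarrow> T w \<in> W'"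
    using W unfolding W'_def E_def subspace_def
    by (auto simp: inner_add_left adj)
  have "W' = {0}"
  proof (rule ccontr)
    assume "W' \<noteq> {0}"
    then obtain v c where "v \<in> W'" "v \<noteq> 0" "T v = c *\<^sub>R v"
      using self_adjoint_eigenvector_exists[OF fin lin adj W'] by blast
    then show False by (auto simp: W'_def E_def)
  qed
  show "W \<subseteq> span {v \<in> W. \<exists>c. T v = c *\<^sub>R v}"
  proof
    fix w assume "w \<in> W"
    obtain p where p: "p \<in> span E" "\<And>u. u \<in> span E \<Longrightarrow> inner (w - p) u = 0"
      using finite_dim_orthogonal_projection[of "span E" B w] fin by auto
    have "w - p \<in> W'"
      using p sub \<open>w \<in> W\<close> W(1) by (auto simp: W'_def E_def span_base intro: subspace_diff)
    then show "w \<in> span {v \<in> W. \<exists>c. T v = c *\<^sub>R v}"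
      using p(1) \<open>W' = {0}\<close> by (simp add: E_def)
  qed
qed

lemma self_adjoint_eigendecomposition:
  fixes T :: "'a::{real_inner,heine_borel} \<Rightarrow> 'a" and B W :: "'a set"
  assumes fin: "finite B" "span B = UNIV" and lin: "linear T"
    and adj: "\<And>x y. inner (T x) y = inner x (T y)"
    and W: "subspace W" "\<And>w. w \<in> W \<Longrightarrow> T w \<in> W" and "w \<in> W"
  obtains b \<Lambda> where "finite \<Lambda>" "\<And>c. b c \<in> W" "\<And>c. T (b c) = c *\<^sub>R b c" "w = (\<Sum>c\<in>\<Lambda>. b c)"
proof -
  interpret linear T by fact
  have "w \<in> span {v \<in> W. \<exists>c. T v = c *\<^sub>R v}"
    using self_adjoint_span_eigenvectors[OF fin lin adj W] \<open>w \<in> W\<close> by simp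
  \<comment> \<open>Vanishing of \<open>b\<close> outside \<open>\<Lambda>\<close> is added so that
    enlarging \<open>\<Lambda>\<close> by a new eigenvalue leaves the old sum unchanged.\<close>
  then have "\<exists>b \<Lambda>. finite \<Lambda> \<and> (\<forall>c. b c \<in> W \<and> T (b c) = c *\<^sub>R b c) \<and> (\<forall>c. c \<notin> \<Lambda> \<longrightarrow> b c = 0)
      \<and> w = (\<Sum>c\<in>\<Lambda>. b c)"
  proof (induction rule: span_induct_alt)
    case base
    show ?case
      by (rule exI[of _ "\<lambda>_. 0"], rule exI[of _ "{}"]) (simp add: zero subspace_0 W(1))
  next
    case (step k v y)
    then obtain b \<Lambda> where b: "finite \<Lambda>" "\<And>c. b c \<in> W" "\<And>c. T (b c) = c *\<^sub>R b c"
      "\<And>c. c \<notin> \<Lambda> \<Longrightarrow> b c = 0" "y = (\<Sum>c\<in>\<Lambda>. b c)" by blast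
    from step obtain a where a: "v \<in> W" "T v = a *\<^sub>R v" by blast
    \<comment> \<open>The new eigenvector joins the component of its own eigenvalue, so each
      eigenvalue keeps a single component.\<close>
    define b' where "b' c = (if c = a then k *\<^sub>R v else 0) + b c" for c
    have "(\<Sum>c\<in>insert a \<Lambda>. b c) = y"
      unfolding b(5) using b(1,4) by (intro sum.mono_neutral_right) auto
    then have "k *\<^sub>R v + y = (\<Sum>c\<in>insert a \<Lambda>. b' c)"
      using b(1) by (simp add: b'_def sum.distrib)
    moreover have "b' c \<in> W \<and> T (b' c) = c *\<^sub>R b' c" for c
      using a b(2,3) W(1)
      by (auto simp: b'_def add scale scaleR_add_right intro: subspace_add subspace_scale)
    moreover have "b' c = 0" if "c \<notin> insert a \<Lambda>" for c
      using that b(4) by (simp add: b'_def)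
    ultimately show ?case
      using b(1) by (intro exI[of _ b'] exI[of _ "insert a \<Lambda>"]) auto
  qed
  then show ?thesis using that by blast
qed

section \<open>Nearest points from the variational inequality\<close>

text \<open>The obtuse angle at \<open>s\<close> gives a Pythagorean inequality. Its term
  \<open>dist a s\<close> yields minimality, and its term \<open>dist y s\<close> forces any other
  minimiser to equal \<open>s\<close>, which settles the choice in
  \<open>closest_point\<close>.\<close>

lemma closest_point_eqI:
  fixes a :: "'a::{real_inner,heine_borel}"
  assumes "s \<in> S" and obtuse: "\<And>y. y \<in> S \<Longrightarrow> inner (a - s) (y - s) \<le> 0"
  shows "closest_point S a = s"
proof -
  have *: "(dist a s)\<^sup>2 + (dist y s)\<^sup>2 \<le> (dist a y)\<^sup>2" if "y \<in> S" for y
  proof -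
    have "(dist a y)\<^sup>2 = (dist a s)\<^sup>2 - 2 * inner (a - s) (y - s) + (dist y s)\<^sup>2"
      using dot_norm_neg[of "a - s" "y - s"] by (simp add: dist_norm)
    with obtuse[OF that] show ?thesis by simp
  qed
  show ?thesis
    unfolding closest_point_def
  proof (rule some_equality)
    show "s \<in> S \<and> (\<forall>y\<in>S. dist a s \<le> dist a y)"
    proof (intro conjI ballI assms(1))
      fix y assume "y \<in> S"
      from *[OF this] have "(dist a s)\<^sup>2 \<le> (dist a y)\<^sup>2"
        using zero_le_power2[of "dist y s"] by linarith
      then show "dist a s \<le> dist a y" by (rule power2_le_imp_le) simp
    qed
  next
    fix y assume y: "y \<in> S \<and> (\<forall>y'\<in>S. dist a y \<le> dist a y')"
    then have "(dist a y)\<^sup>2 \<le> (dist a s)\<^sup>2"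
      using assms(1) by (intro power_mono) auto
    then have "(dist y s)\<^sup>2 \<le> 0" using *[of y] y by linarith
    then show "y = s" by simp
  qed
qed

section \<open>Jordan identities and commuting powers\<close>

context euclidean_jordan_algebra
begin

lemma linear_jmul: "linear (\<lambda>y. x \<bullet>\<^sub>J y)"
  using bilinear_jmul unfolding bilinear_def by blast

lemma jmul_add_right: "x \<bullet>\<^sub>J (y + z) = x \<bullet>\<^sub>J y + x \<bullet>\<^sub>J z"
  by (rule linear_add[OF linear_jmul])

lemma jmul_add_left: "(y + z) \<bullet>\<^sub>J x = y \<bullet>\<^sub>J x + z \<bullet>\<^sub>J x"
  by (metis jmul_add_right jmul_commute)

lemma jmul_scaleR_right: "x \<bullet>\<^sub>J (r *\<^sub>R y) = r *\<^sub>R (x \<bullet>\<^sub>J y)"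
  by (rule linear_scale[OF linear_jmul])

lemma jmul_scaleR_left: "(r *\<^sub>R y) \<bullet>\<^sub>J x = r *\<^sub>R (y \<bullet>\<^sub>J x)"
  by (metis jmul_scaleR_right jmul_commute)

lemma jmul_zero_right [simp]: "x \<bullet>\<^sub>J 0 = 0"
  by (rule linear_0[OF linear_jmul])

lemma jmul_zero_left [simp]: "0 \<bullet>\<^sub>J x = 0"
  by (metis jmul_zero_right jmul_commute)

lemma jmul_sum_right: "x \<bullet>\<^sub>J sum f A = (\<Sum>i\<in>A. x \<bullet>\<^sub>J f i)"
  by (rule linear_sum[OF linear_jmul])

lemma jmul_sum_left: "sum f A \<bullet>\<^sub>J x = (\<Sum>i\<in>A. f i \<bullet>\<^sub>J x)"
  by (simp add: jmul_commute[of _ x] jmul_sum_right)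

lemma jordan_identity_linearized:
  "(a \<bullet>\<^sub>J b) \<bullet>\<^sub>J (c \<bullet>\<^sub>J y) + (b \<bullet>\<^sub>J c) \<bullet>\<^sub>J (a \<bullet>\<^sub>J y) + (c \<bullet>\<^sub>J a) \<bullet>\<^sub>J (b \<bullet>\<^sub>J y)
    = a \<bullet>\<^sub>J ((b \<bullet>\<^sub>J c) \<bullet>\<^sub>J y) + b \<bullet>\<^sub>J ((c \<bullet>\<^sub>J a) \<bullet>\<^sub>J y) + c \<bullet>\<^sub>J ((a \<bullet>\<^sub>J b) \<bullet>\<^sub>J y)"
  (is "?l = ?r")
proof -
  define F where "F x = (x \<bullet>\<^sub>J x) \<bullet>\<^sub>J (x \<bullet>\<^sub>J y) - x \<bullet>\<^sub>J ((x \<bullet>\<^sub>J x) \<bullet>\<^sub>J y)" for x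
  have F: "F x = 0" for x by (simp add: F_def jordan_identity)
  \<comment> \<open>Full polarization of the cubic map \<open>F\<close>: only terms with each of
    \<open>a\<close>, \<open>b\<close>, \<open>c\<close> once survive, and commutativity makes each
    appear twice.\<close>
  have "F (a + b + c) - F (a + b) - F (b + c) - F (a + c) + F a + F b + F c = 2 *\<^sub>R (?l - ?r)"
    unfolding F_def scaleR_2
    by (simp add: jmul_add_left jmul_add_right jmul_commute[of b a] jmul_commute[of c a]
        jmul_commute[of c b])
  then show ?thesis by (simp add: F)
qed

text \<open>The left side of the linearized identity is symmetric in all four variables, so its
  right side is unchanged when \<open>a\<close> and \<open>y\<close> are swapped. This expresses
  multiplication by a triple product through multiplications by shorter ones.\<close>

lemma jmul_triple:
  "(a \<bullet>\<^sub>J (b \<bullet>\<^sub>J c)) \<bullet>\<^sub>J y = a \<bullet>\<^sub>J ((b \<bullet>\<^sub>J c) \<bullet>\<^sub>J y) + b \<bullet>\<^sub>J ((c \<bullet>\<^sub>J a) \<bullet>\<^sub>J y) + c \<bullet>\<^sub>J ((a \<bullet>\<^sub>J b) \<bullet>\<^sub>J y)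
    - b \<bullet>\<^sub>J (a \<bullet>\<^sub>J (c \<bullet>\<^sub>J y)) - c \<bullet>\<^sub>J (a \<bullet>\<^sub>J (b \<bullet>\<^sub>J y))"
proof -
  have "a \<bullet>\<^sub>J ((b \<bullet>\<^sub>J c) \<bullet>\<^sub>J y) + b \<bullet>\<^sub>J ((c \<bullet>\<^sub>J a) \<bullet>\<^sub>J y) + c \<bullet>\<^sub>J ((a \<bullet>\<^sub>J b) \<bullet>\<^sub>J y)
      = y \<bullet>\<^sub>J ((b \<bullet>\<^sub>J c) \<bullet>\<^sub>J a) + b \<bullet>\<^sub>J ((c \<bullet>\<^sub>J y) \<bullet>\<^sub>J a) + c \<bullet>\<^sub>J ((y \<bullet>\<^sub>J b) \<bullet>\<^sub>J a)"
    using jordan_identity_linearized[of a b c y] jordan_identity_linearized[of y b c a]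
    by (simp add: jmul_commute add_ac)
  then show ?thesis
    by (simp add: jmul_commute algebra_simps)
qed

text \<open>Powers are \<open>z^(k+1)\<close>, so that non-unital subalgebras contain them.\<close>

definition jpow :: "'a \<Rightarrow> nat \<Rightarrow> 'a"
  where "jpow z k = ((\<bullet>\<^sub>J) z ^^ k) z"

lemma jpow_0 [simp]: "jpow z 0 = z"
  and jpow_Suc [simp]: "jpow z (Suc k) = z \<bullet>\<^sub>J jpow z k"
  by (simp_all add: jpow_def)

text \<open>Multiplication by a power obeys a two-step recursion whose coefficients are
  multiplications by \<open>z\<close> and its square. These two commute by the Jordan identity; both
  commutation claims are carried because the square occurs in the recursion.\<close>

lemma jpow_commute_aux:
  "jpow z k \<bullet>\<^sub>J (z \<bullet>\<^sub>J y) = z \<bullet>\<^sub>J (jpow z k \<bullet>\<^sub>J y) \<and>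
   jpow z k \<bullet>\<^sub>J ((z \<bullet>\<^sub>J z) \<bullet>\<^sub>J y) = (z \<bullet>\<^sub>J z) \<bullet>\<^sub>J (jpow z k \<bullet>\<^sub>J y)"
proof (induction k arbitrary: y rule: induct_nat_012)
  case (ge2 k)
  have L: "jpow z (Suc (Suc k)) \<bullet>\<^sub>J u = 2 *\<^sub>R (z \<bullet>\<^sub>J (jpow z (Suc k) \<bullet>\<^sub>J u))
      + jpow z k \<bullet>\<^sub>J ((z \<bullet>\<^sub>J z) \<bullet>\<^sub>J u) - jpow z k \<bullet>\<^sub>J (z \<bullet>\<^sub>J (z \<bullet>\<^sub>J u)) - z \<bullet>\<^sub>J (z \<bullet>\<^sub>J (jpow z k \<bullet>\<^sub>J u))"
    for u
    using jmul_triple[of z "jpow z k" z u] by (simp add: jmul_commute[of "jpow z k" z] scaleR_2)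
  note ge2' = ge2(1)[THEN conjunct1] ge2(1)[THEN conjunct2]
    ge2(2)[THEN conjunct1] ge2(2)[THEN conjunct2]
  show ?case
    unfolding L jmul_add_right linear_diff[OF linear_jmul] jmul_scaleR_right ge2' jordan_identity
    by simp
qed (simp_all add: jordan_identity)

lemmas jpow_commute = jpow_commute_aux[THEN conjunct1]

text \<open>The eigenvalues of multiplication by an idempotent lie in {0, 1/2, 1}, and there
  \<open>t = t\<^sup>2 + 4 * (t - t\<^sup>2)\<^sup>2\<close>.\<close>

lemma idempotent_inner_square_nonneg:
  assumes "c \<bullet>\<^sub>J c = c"
  shows "0 \<le> inner c (x \<bullet>\<^sub>J x)"
proof -
  define f where "f = c \<bullet>\<^sub>J x"
  define g where "g = c \<bullet>\<^sub>J f"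
  define h where "h = c \<bullet>\<^sub>J g"
  \<comment> \<open>Taking all three factors equal to \<open>c\<close> gives
    \<open>2t^3 - 3t^2 + t = 0\<close> for multiplication by \<open>c\<close>, with roots 0, 1/2 and
    1.\<close>
  have "f + 2 *\<^sub>R h = 3 *\<^sub>R g"
    using jmul_triple[of c c c x] assms unfolding f_def g_def h_def
    by (simp add: scaleR_2 scaleR_left_distrib[of 2 1, simplified] algebra_simps)
  then have *: "inner f y + 2 * inner h y = 3 * inner g y" for y
    by (metis inner_add_left inner_scaleR_left)
  have "inner g x = inner f f" "inner h x = inner g f" "inner h f = inner g g"
    by (simp_all only: f_def g_def h_def jmul_assoc_inner)
  then have "inner f x = inner f f + 4 * inner (f - g) (f - g)"
    using *[of x] *[of f] by (simp add: inner_diff_left inner_diff_right inner_commute[of f g])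
  also have "\<dots> \<ge> 0" by simp
  finally show ?thesis
    by (metis f_def jmul_assoc_inner jmul_commute)
qed

section \<open>Spectral decomposition and positive parts inside a subalgebra\<close>

lemma spectral_decomposition:
  assumes "jordan_subalgebra (\<bullet>\<^sub>J) L" and "z \<in> L"
  obtains b \<Lambda> where "finite \<Lambda>" "\<And>c. b c \<in> L" "\<And>c. b c \<bullet>\<^sub>J b c = c *\<^sub>R b c"
    "\<And>c d. c \<noteq> d \<Longrightarrow> b c \<bullet>\<^sub>J b d = 0" "z = (\<Sum>c\<in>\<Lambda>. b c)"
proof -
  obtain B :: "'a set" where B: "finite B" "span B = UNIV"
    using finite_dim by blast
  have L: "subspace L" "\<And>x y. x \<in> L \<Longrightarrow> y \<in> L \<Longrightarrow> x \<bullet>\<^sub>J y \<in> L"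
    using assms(1) by (auto simp: jordan_subalgebra_def)
  define W where "W = span (range (jpow z))"
  have "subspace W" unfolding W_def by (rule subspace_span)
  have "jpow z k \<in> L" for k
    using assms(2) L(2) by (induction k) auto
  then have "W \<subseteq> L"
    unfolding W_def using L(1) by (intro span_minimal) auto
  have invariant: "z \<bullet>\<^sub>J w \<in> W" if "w \<in> W" for w
    using that unfolding W_def
  proof (induction rule: span_induct_alt)
    case (step r x y)
    then have "z \<bullet>\<^sub>J x \<in> range (jpow z)" by (auto simp flip: jpow_Suc)
    with step show ?case
      by (simp add: jmul_add_right jmul_scaleR_right span_add span_scale span_base)
  qed (simp add: span_zero)
  have commute: "w \<bullet>\<^sub>J (z \<bullet>\<^sub>J y) = z \<bullet>\<^sub>J (w \<bullet>\<^sub>J y)" if "w \<in> W" for w y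
    using that unfolding W_def
  proof (induction rule: span_induct_alt)
    case (step r x u)
    then show ?case
      by (auto simp: jmul_add_left jmul_add_right jmul_scaleR_left jmul_scaleR_right jpow_commute)
  qed simp
  have "z \<in> W"
    unfolding W_def by (metis jpow_0 rangeI span_base)
  obtain b \<Lambda> where b: "finite \<Lambda>" "\<And>c. b c \<in> W" "\<And>c. z \<bullet>\<^sub>J b c = c *\<^sub>R b c" "z = (\<Sum>c\<in>\<Lambda>. b c)"
  proof (rule self_adjoint_eigendecomposition[of B "(\<bullet>\<^sub>J) z" W z])
    show "linear ((\<bullet>\<^sub>J) z)" by (rule linear_jmul)
    show "inner (z \<bullet>\<^sub>J x) y = inner x (z \<bullet>\<^sub>J y)" for x y by (rule jmul_assoc_inner)
  qed (use B \<open>subspace W\<close> invariant \<open>z \<in> W\<close> in blast)+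
  \<comment> \<open>Since \<open>b c\<close> and \<open>b d\<close> both lie in \<open>W\<close>,
    their product is scaled by \<open>z\<close> with factor \<open>c\<close> and also with factor
    \<open>d\<close>.\<close>
  have orth: "b c \<bullet>\<^sub>J b d = 0" if "c \<noteq> d" for c d
  proof -
    have "d *\<^sub>R (b c \<bullet>\<^sub>J b d) = z \<bullet>\<^sub>J (b c \<bullet>\<^sub>J b d)" for c d
      using commute[OF b(2), of c "b d"] by (simp add: b(3) jmul_scaleR_right)
    from this[of d c] this[of c d] have "c *\<^sub>R (b c \<bullet>\<^sub>J b d) = d *\<^sub>R (b c \<bullet>\<^sub>J b d)"
      by (simp add: jmul_commute)
    then show ?thesis using that by simp
  qed
  have square: "b c \<bullet>\<^sub>J b c = c *\<^sub>R b c" if "c \<in> \<Lambda>" for c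
  proof -
    \<comment> \<open>Expanding \<open>z\<close> as the sum of its components in
      \<open>z \<bullet>\<^sub>J b c\<close> leaves only the square of \<open>b c\<close>.\<close>
    have "c *\<^sub>R b c = (\<Sum>d\<in>\<Lambda>. b d \<bullet>\<^sub>J b c)"
      using b(3)[of c] b(4) jmul_sum_left[of b \<Lambda> "b c"] by simp
    also have "\<dots> = (\<Sum>d\<in>\<Lambda>. if d = c then b c \<bullet>\<^sub>J b c else 0)"
      using orth by (intro sum.cong) auto
    finally show ?thesis using b(1) that by simp
  qed
  show ?thesis
  \<comment> \<open>Components outside \<open>\<Lambda>\<close> are reset to zero because
    \<open>square\<close> covers only indices in \<open>\<Lambda>\<close>.\<close>
  proof (rule that[of \<Lambda> "\<lambda>c. if c \<in> \<Lambda> then b c else 0"])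
    show "(if c \<in> \<Lambda> then b c else 0) \<in> L" for c
      using b(2) \<open>W \<subseteq> L\<close> subspace_0[OF L(1)] by auto
  qed (use b square orth in auto)
qed

text \<open>This is the Moreau decomposition of \<open>z\<close>: \<open>n\<close> lies in the dual
  of the cone of squares and is orthogonal to \<open>p\<close>, as the variational inequality
  requires.\<close>

lemma positive_negative_parts:
  assumes "jordan_subalgebra (\<bullet>\<^sub>J) L" and "z \<in> L"
  obtains p n where "z = p - n" "p \<in> L" "p \<in> cone_of_squares (\<bullet>\<^sub>J)" "inner n p = 0"
    "\<And>q. q \<in> cone_of_squares (\<bullet>\<^sub>J) \<Longrightarrow> 0 \<le> inner n q"
proof -
  obtain b \<Lambda> where b: "finite \<Lambda>" "\<And>c. b c \<in> L" "\<And>c. b c \<bullet>\<^sub>J b c = c *\<^sub>R b c"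
    "\<And>c d. c \<noteq> d \<Longrightarrow> b c \<bullet>\<^sub>J b d = 0" "z = (\<Sum>c\<in>\<Lambda>. b c)"
    using spectral_decomposition[OF assms] by blast
  \<comment> \<open>With the unit, a vanishing Jordan product implies orthogonality.\<close>
  have inner_jmul: "inner x y = inner e (x \<bullet>\<^sub>J y)" for x y
    by (metis jmul_assoc_inner jmul_commute unit)
  define P where "P = {c \<in> \<Lambda>. 0 < c}"
  define p where "p = (\<Sum>c\<in>P. b c)"
  define n where "n = (\<Sum>c\<in>\<Lambda>-P. - b c)"
  have "finite P" "P \<subseteq> \<Lambda>" using b(1) by (auto simp: P_def)
  have "z = p - n"
    unfolding b(5) p_def n_def sum_negf
    using sum.subset_diff[OF \<open>P \<subseteq> \<Lambda>\<close> b(1), of b] by (simp add: add.commute)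
  moreover have "p \<in> L"
    unfolding p_def using b(2) assms(1) by (intro subspace_sum) (auto simp: jordan_subalgebra_def)
  moreover have "p \<in> cone_of_squares (\<bullet>\<^sub>J)"
  proof -
    \<comment> \<open>A square root of \<open>p\<close>: the weights cancel the factor
      \<open>c\<close> in the square of \<open>b c\<close>, and mixed products vanish.\<close>
    define u where "u = (\<Sum>c\<in>P. (1 / sqrt c) *\<^sub>R b c)"
    have "u \<bullet>\<^sub>J u = (\<Sum>c\<in>P. \<Sum>d\<in>P. (1 / (sqrt c * sqrt d)) *\<^sub>R (b c \<bullet>\<^sub>J b d))"
      unfolding u_def by (simp add: jmul_sum_left jmul_sum_right jmul_scaleR_left jmul_scaleR_right
          scaleR_sum_right jmul_commute mult.commute)
    also have "\<dots> = (\<Sum>c\<in>P. \<Sum>d\<in>P. if d = c then b c else 0)"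
      using b(3,4) by (intro sum.cong refl) (auto simp: P_def)
    also have "\<dots> = p"
      using \<open>finite P\<close> by (simp add: p_def)
    finally show ?thesis
      unfolding cone_of_squares_def by auto
  qed
  moreover have "inner n p = 0"
  proof -
    have "inner (b c) (b d) = 0" if "c \<notin> P" "d \<in> P" for c d
      using that b(4)[of c d] inner_jmul[of "b c" "b d"] by (cases "c = d") auto
    then show ?thesis
      unfolding n_def p_def inner_sum_left inner_sum_right by (simp add: sum.neutral)
  qed
  moreover have "0 \<le> inner n q" if q: "q \<in> cone_of_squares (\<bullet>\<^sub>J)" for q
  proof -
    obtain x where x: "q = x \<bullet>\<^sub>J x" using q by (auto simp: cone_of_squares_def)
    have "inner (b c) q \<le> 0" if "c \<in> \<Lambda> - P" for c
    proof (cases "c = 0")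
      \<comment> \<open>The component at eigenvalue zero has square zero, hence norm zero.\<close>
      case True
      then have "b c = 0" using inner_jmul[of "b c" "b c"] b(3)[of c] by simp
      then show ?thesis by simp
    next
      case False
      \<comment> \<open>Here \<open>c\<close> is negative, so passing from the idempotent
        \<open>i\<close> back to \<open>b c\<close> reverses the sign.\<close>
      define i where "i = (1 / c) *\<^sub>R b c"
      have "i \<bullet>\<^sub>J i = i" using False b(3)[of c] by (simp add: i_def jmul_scaleR_left jmul_scaleR_right)
      then have "0 \<le> inner (b c) q / c"
        using idempotent_inner_square_nonneg[of i x] by (simp add: i_def x)
      then show ?thesis using that False by (auto simp: P_def zero_le_divide_iff)
    qed
    then show ?thesis
      unfolding n_def inner_sum_left by (intro sum_nonneg) simp
  qed
  ultimately show ?thesis using that by blast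
qed

end

section \<open>Projection onto translates of the cone and of its negative\<close>

theorem theorem3:
  fixes jmul :: "'a::{real_inner,heine_borel} \<Rightarrow> 'a \<Rightarrow> 'a" and e :: 'a and L :: "'a set"
  assumes "euclidean_jordan_algebra jmul e"
    and "jordan_subalgebra jmul L"
  shows "lattice_like_subspace (cone_of_squares jmul) L"
proof -
  interpret euclidean_jordan_algebra jmul e by fact
  have L: "subspace L" using assms(2) by (simp add: jordan_subalgebra_def)
  have "lmeet (cone_of_squares jmul) x y \<in> L" if xy: "x \<in> L" "y \<in> L" for x y
  proof -
    obtain p n where pn: "x - y = p - n" "p \<in> L" "p \<in> cone_of_squares jmul" "inner n p = 0"
      "\<And>q. q \<in> cone_of_squares jmul \<Longrightarrow> 0 \<le> inner n q"
      using positive_negative_parts[OF assms(2) subspace_diff[OF L xy]] by blast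
    \<comment> \<open>The residual is \<open>n\<close>; for a competitor \<open>x - q\<close> the
      variational inequality reads \<open>inner n (p - q) \<le> 0\<close>.\<close>
    have "y - (x - p) = n" using pn(1) by (simp add: algebra_simps)
    then have "lmeet (cone_of_squares jmul) x y = x - p"
      unfolding lmeet_def using pn(3-5)
      by (intro closest_point_eqI) (auto simp: inner_diff_right)
    then show ?thesis using subspace_diff[OF L xy(1) pn(2)] by simp
  qed
  moreover have "ljoin (cone_of_squares jmul) x y \<in> L" if xy: "x \<in> L" "y \<in> L" for x y
  proof -
    obtain p n where pn: "y - x = p - n" "p \<in> L" "p \<in> cone_of_squares jmul" "inner n p = 0"
      "\<And>q. q \<in> cone_of_squares jmul \<Longrightarrow> 0 \<le> inner n q"
      using positive_negative_parts[OF assms(2) subspace_diff[OF L xy(2,1)]] by blast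
    \<comment> \<open>The residual changes sign, and so does the direction \<open>q - p\<close> to a
      competitor \<open>x + q\<close>.\<close>
    have "y - (x + p) = - n" using pn(1) by (simp add: algebra_simps)
    then have "ljoin (cone_of_squares jmul) x y = x + p"
      unfolding ljoin_def using pn(3-5)
      by (intro closest_point_eqI) (auto simp: inner_add_right inner_diff_right)
    then show ?thesis using subspace_add[OF L xy(1) pn(2)] by simp
  qed
  ultimately show ?thesis
    using L by (simp add: lattice_like_subspace_def lattice_like_def)
qed

end
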